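(* Let $n,N\in\mathbb N_+$ and consider the leader-follower multi-agent system $\dot x_i=Ax_i+Bu_i$, $i=0,\dots,N$, $u_0=0$, with communication weights $w_{ij}$, as described in the context. Let $\lambda>0$. Let the transmitted vectors $v_i\in\mathbb R^n$ be given by $$v_0=\mathbf 0_n,\qquad v_i=\frac{1}{\sum_{j=0}^N w_{ij}}\sum_{j=0}^N w_{ij}\,(x_i-x_j+v_j),\quad i=1,\dots,N,$$ and let the consensus control protocol be $$u_i=-K_{lin}v_i,\qquad K_{lin}=\eta_1^\top(A+\lambda I_n)^n,\qquad i=1,\dots,N .$$ Define $h_k=-\eta_1^\top(A+\lambda I_n)^{k-1}$, $k=1,\dots,n$, let $H\in\mathbb R^{n\times n}$ be the matrix with rows $h_1,\dots,h_n$, and let $$\Omega=\{e\in\mathbb R^{Nn}:(I_N\otimes H)e\ge0\}\subset\Sigma=\{e\in\mathbb R^{Nn}:(I_N\otimes\eta_1^\top)e\le0\}.$$ Then the control asymptotically stabilizes the closed-loop error equation $\dot e=f(e)$ and renders $\Omega$ strictly positively invariant for it. Moreover, if $$\sum_{\zeta=0}^{k-1}C_\zeta^{k-1}\lambda^{\zeta}\,\eta_{k-\zeta}^\top e_i(0)\le0\qquad\text{for all }k=2,\dots,n\text{ and all }i=1,\dots,N,$$ with $C_\zeta^{k-1}=\frac{(k-1)!}{(k-1-\zeta)!\,\zeta!}$, then $e(0)\in\Omega$.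
   Context: Agents: $x_i(t)\in\mathbb R^n$, $i=0,\dots,N$; agent $0$ is the leader with $u_0=0$, agents $1,\dots,N$ are followers with scalar inputs $u_i$. $A=\begin{pmatrix}\mathbf 0_{n-1}&I_{n-1}\\0&\mathbf 0_{n-1}^\top\end{pmatrix}\in\mathbb R^{n\times n}$, $B=\begin{pmatrix}\mathbf 0_{n-1}\\1\end{pmatrix}\in\mathbb R^n$ (integrator chain). $\eta_1,\dots,\eta_n$ is the canonical basis of $\mathbb R^n$. Vector inequalities $\ge0$, $\le0$ are componentwise; $\otimes$ is the Kronecker product. Communication graph: a fixed directed graph on vertices $\{0,\dots,N\}$ with edge set $\mathcal E$; $(i,j)\in\mathcal E$ means that $j$ sends information to $i$; $w_{ij}=1$ if $(i,j)\in\mathcal E$ and $w_{ij}=0$ otherwise; no self-loops ($w_{ii}=0$). Vertex $0$ is the root: it has no incoming edges ($w_{0j}=0$ for all $j$), and every vertex $1,\dots,N$ is the endpoint of at least one directed path starting at $0$. Consensus error: $e_i=x_i-x_0$, $e=(e_1^\top,\dots,e_N^\top)^\top\in\mathbb R^{Nn}$. The closed-loop error equation $\dot e=f(e)$ is the differential equation obtained from $\dot e_i=Ae_i+Bu_i$, $i=1,\dots,N$, by substituting the control protocol (the equations for the $v_i$ determine them uniquely). A set $\Omega$ is strictly positively invariant for the error equation if $e(0)\in\Omega$ implies $e(t)\in\Omega$ for all $t>0$.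
   Formalization: In the last sentence the hypothesis e(0) ∈ Σ (i.e. η_1^T e_i(0) ≤ 0 for all i) is added; without it the claim is false, e.g. n=1, e_1(0)=1, and since Ω ⊂ Σ it fails for every e(0) outside Σ. *)

theory Defs
  imports "HOL-Analysis.Analysis"
begin

section \<open>Vectors and matrices with ordered index types\<close>

text \<open>The dimension \<open>n\<close> is \<open>CARD('n)\<close> for a finite, linearly ordered index type. The elements of
  \<open>'n\<close> are numbered \<open>1, \<dots>, n\<close> in increasing order, so that coordinates can be addressed by natural
  numbers as in \<open>\<eta>\<^sub>1, \<dots>, \<eta>\<^sub>n\<close>.\<close>

definition pos :: "'n::{finite,linorder} \<Rightarrow> nat" where
  "pos i = card {j. j \<le> i}"

definition eta :: "nat \<Rightarrow> real^'n::{finite,linorder}" where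
  "eta k = (\<chi> i. if pos i = k then 1 else 0)"

lemma pos_strict_mono: "i < j \<Longrightarrow> pos i < pos j"
  unfolding pos_def by (rule psubset_card_mono) (auto simp: psubset_eq set_eq_iff intro!: exI[of _ j])

lemma bij_betw_pos: "bij_betw (pos :: 'n::{finite,linorder} \<Rightarrow> nat) UNIV {1..CARD('n)}"
proof -
  have inj: "inj (pos :: 'n \<Rightarrow> nat)"
    by (metis injI linorder_neqE nat_neq_iff pos_strict_mono)
  have "1 \<le> pos i" for i :: 'n
    unfolding pos_def by (simp add: Suc_le_eq card_gt_0_iff) blast
  moreover have "pos i \<le> CARD('n)" for i :: 'n
    unfolding pos_def by (rule card_mono) auto
  ultimately have "range (pos :: 'n \<Rightarrow> nat) \<subseteq> {1..CARD('n)}"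
    by auto
  moreover have "card (range (pos :: 'n \<Rightarrow> nat)) = card {1..CARD('n)}"
    using inj by (simp add: card_image)
  ultimately have "range (pos :: 'n \<Rightarrow> nat) = {1..CARD('n)}"
    by (simp add: card_subset_eq)
  with inj show ?thesis
    by (simp add: bij_betw_def)
qed

text \<open>The type-class product \<open>*\<close> on \<open>real^'n^'n\<close> is entrywise, so powers are defined through \<open>**\<close>.\<close>

fun matrix_power :: "real^'n^'n \<Rightarrow> nat \<Rightarrow> real^'n^'n" where
  "matrix_power M 0 = mat 1"
| "matrix_power M (Suc k) = M ** matrix_power M k"

definition kronecker :: "real^'b^'a \<Rightarrow> real^'d^'c \<Rightarrow> real^('b \<times> 'd)^('a \<times> 'c)" (infixr \<open>\<otimes>\<^sub>K\<close> 70) where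
  "P \<otimes>\<^sub>K Q = (\<chi> p q. P $ fst p $ fst q * Q $ snd p $ snd q)"


section \<open>Integrator chain and communication graph\<close>

definition chain_A :: "real^('n::{finite,linorder})^('n::{finite,linorder})" where
  "chain_A = (\<chi> i j. if pos j = pos i + 1 then 1 else 0)"

definition chain_B :: "real^'n::{finite,linorder}" where
  "chain_B = eta CARD('n)"

text \<open>The agents are the elements of \<open>'N option\<close> with \<open>N = CARD('N)\<close>: \<open>None\<close> is the leader (agent 0)
  and \<open>Some i\<close> are the followers. A pair \<open>(i, j) \<in> E\<close> means that \<open>j\<close> sends information to \<open>i\<close>, so
  directed paths follow the converse of \<open>E\<close>.\<close>

definition leader_rooted :: "('N option \<times> 'N option) set \<Rightarrow> bool" where
  "leader_rooted E \<longleftrightarrow>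
     (\<forall>i. (i, i) \<notin> E) \<and> (\<forall>j. (None, j) \<notin> E) \<and> (\<forall>i. (None, Some i) \<in> (E\<inverse>)\<^sup>+)"

definition weight :: "('a \<times> 'a) set \<Rightarrow> 'a \<Rightarrow> 'a \<Rightarrow> real" where
  "weight E i j = (if (i, j) \<in> E then 1 else 0)"


section \<open>Control protocol and closed-loop error equation\<close>

definition transmitted ::
  "('N::finite option \<times> 'N option) set \<Rightarrow> ('N option \<Rightarrow> real^'n) \<Rightarrow> ('N option \<Rightarrow> real^'n) \<Rightarrow> bool" where
  "transmitted E x v \<longleftrightarrow>
     v None = 0 \<and>
     (\<forall>i. v (Some i) =
        (1 / (\<Sum>j\<in>UNIV. weight E (Some i) j)) *\<^sub>R
          (\<Sum>j\<in>UNIV. weight E (Some i) j *\<^sub>R (x (Some i) - x j + v j)))"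

definition K_lin :: "real \<Rightarrow> real^'n::{finite,linorder}" where
  "K_lin lam = eta 1 v* matrix_power (chain_A + lam *\<^sub>R mat 1) CARD('n)"

definition control :: "real \<Rightarrow> ('N option \<Rightarrow> real^'n::{finite,linorder}) \<Rightarrow> 'N \<Rightarrow> real" where
  "control lam v i = - (K_lin lam \<bullet> v (Some i))"

definition error :: "('N::finite option \<Rightarrow> real^('n::finite)) \<Rightarrow> real^('N \<times> 'n::finite)" where
  "error x = (\<chi> p. (x (Some (fst p)) - x None) $ snd p)"

definition block :: "real^('N::finite \<times> 'n::finite) \<Rightarrow> 'N \<Rightarrow> real^'n" where
  "block e i = (\<chi> k. e $ (i, k))"

text \<open>The defining equations of the \<open>v\<^sub>i\<close> contain the states only through the differences
  \<open>x\<^sub>i - x\<^sub>j\<close>. To write the closed loop in terms of \<open>e\<close> one may therefore use the states relative to the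
  leader, that is \<open>0\<close> for the leader and \<open>e\<^sub>i\<close> for follower \<open>i\<close>; the lemma \<open>block_closed_loop\<close> below
  shows that any other choice of states with error \<open>e\<close> gives the same right-hand side.\<close>

definition relative_state :: "real^('N::finite \<times> 'n::finite) \<Rightarrow> 'N option \<Rightarrow> real^'n" where
  "relative_state e a = (case a of None \<Rightarrow> 0 | Some i \<Rightarrow> block e i)"

definition closed_loop ::
  "('N::finite option \<times> 'N option) set \<Rightarrow> real \<Rightarrow> real^('N \<times> 'n::{finite,linorder}) \<Rightarrow> real^('N \<times> 'n)" where
  "closed_loop E lam e =
     (let v = (THE v. transmitted E (relative_state e) v)
      in (\<chi> p. (chain_A *v block e (fst p) + control lam v (fst p) *\<^sub>R chain_B) $ snd p))"

lemma weight_sum_pos: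
  fixes E :: "('N::finite option \<times> 'N option) set"
  assumes "leader_rooted E"
  shows "0 < (\<Sum>j\<in>UNIV. weight E (Some i) j)"
proof -
  from assms have "(None, Some i) \<in> (E\<inverse>)\<^sup>+"
    by (auto simp: leader_rooted_def)
  then obtain j where "(Some i, j) \<in> E"
    by (meson converseD tranclD2)
  then have "0 < weight E (Some i) j"
    by (simp add: weight_def)
  then show ?thesis
    by (intro sum_pos2[of UNIV j]) (auto simp: weight_def)
qed

lemma transmitted_exists:
  fixes E :: "('N::finite option \<times> 'N option) set"
  assumes "leader_rooted E"
  shows "transmitted E x (\<lambda>a. x a - x None)"
  using weight_sum_pos[OF assms]
  by (auto simp: transmitted_def scaleR_left.sum[symmetric] less_imp_neq[symmetric] simp del: sum.neutral_const)

lemma transmitted_unique: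
  fixes E :: "('N::finite option \<times> 'N option) set" and x :: "'N option \<Rightarrow> real^'n"
  assumes G: "leader_rooted E" and v: "transmitted E x v"
  shows "v = (\<lambda>a. x a - x None)"
proof -
  define d where "d a = v a - (x a - x None)" for a
  define M where "M = Max (range (\<lambda>a. norm (d a)))"
  have le_M: "norm (d a) \<le> M" for a
    unfolding M_def by (rule Max_ge) auto
  have d_None: "d None = 0"
    using v by (simp add: d_def transmitted_def)
  have avg: "(\<Sum>j\<in>UNIV. weight E (Some i) j) *\<^sub>R d (Some i) = (\<Sum>j\<in>UNIV. weight E (Some i) j *\<^sub>R d j)" for i
  proof -
    let ?w = "weight E (Some i)"
    have "sum ?w UNIV *\<^sub>R v (Some i) = (\<Sum>j\<in>UNIV. ?w j *\<^sub>R (x (Some i) - x j + v j))"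
      using v weight_sum_pos[OF G, of i] by (simp add: transmitted_def)
    also have "\<dots> = (\<Sum>j\<in>UNIV. ?w j *\<^sub>R d j + ?w j *\<^sub>R (x (Some i) - x None))"
      by (intro sum.cong refl) (simp add: d_def algebra_simps)
    also have "\<dots> = (\<Sum>j\<in>UNIV. ?w j *\<^sub>R d j) + sum ?w UNIV *\<^sub>R (x (Some i) - x None)"
      by (simp add: sum.distrib scaleR_left.sum)
    finally show ?thesis
      by (simp add: d_def algebra_simps)
  qed
  have step: "norm (d j) = M" if ij: "(i, j) \<in> E" and i: "norm (d i) = M" for i j
  proof -
    from ij G obtain k where k: "i = Some k"
      by (cases i) (auto simp: leader_rooted_def)
    let ?w = "weight E i"
    have w0: "0 \<le> ?w a" for a
      by (simp add: weight_def)
    have "sum ?w UNIV * M = norm (sum ?w UNIV *\<^sub>R d i)"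
      using i w0 by (simp add: sum_nonneg)
    also have "\<dots> \<le> (\<Sum>a\<in>UNIV. ?w a * norm (d a))"
      unfolding k avg by (rule order_trans[OF norm_sum]) (simp add: weight_def)
    finally have "(\<Sum>a\<in>UNIV. ?w a * (M - norm (d a))) \<le> 0"
      by (simp add: right_diff_distrib sum_subtractf sum_distrib_right)
    moreover have nonneg: "0 \<le> ?w a * (M - norm (d a))" for a
      using w0 le_M by simp
    ultimately have "(\<Sum>a\<in>UNIV. ?w a * (M - norm (d a))) = 0"
      by (meson order_antisym sum_nonneg)
    then have "?w j * (M - norm (d j)) = 0"
      using nonneg by (simp add: sum_nonneg_eq_0_iff)
    with ij show ?thesis
      by (simp add: weight_def)
  qed
  have zero: "M = 0" if "(None, a) \<in> (E\<inverse>)\<^sup>*" "norm (d a) = M" for a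
    using that by (induction rule: rtrancl_induct) (use step d_None in auto)
  have "M \<in> range (\<lambda>a. norm (d a))"
    unfolding M_def by (rule Max_in) auto
  then obtain a where a: "norm (d a) = M"
    by auto
  have "(None, a) \<in> (E\<inverse>)\<^sup>*"
    using G by (cases a) (auto simp: leader_rooted_def trancl_into_rtrancl)
  from zero[OF this a] le_M have "d b = 0" for b
    by (metis norm_le_zero_iff)
  then show ?thesis
    by (auto simp: d_def fun_eq_iff)
qed

lemma block_closed_loop:
  fixes E :: "('N::finite option \<times> 'N option) set"
  assumes G: "leader_rooted E" and v: "transmitted E x v"
  shows "block (closed_loop E lam (error x)) i =
           chain_A *v (x (Some i) - x None) + control lam v i *\<^sub>R chain_B"
proof -
  let ?r = "relative_state (error x)"
  have "(THE v. transmitted E ?r v) = (\<lambda>a. ?r a - ?r None)"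
    using transmitted_exists[OF G] transmitted_unique[OF G] by (intro the_equality) auto
  also have "\<dots> = v"
    unfolding transmitted_unique[OF G v]
    by (auto simp: fun_eq_iff relative_state_def error_def block_def vec_eq_iff split: option.splits)
  finally show ?thesis
    by (simp add: closed_loop_def block_def error_def vec_eq_iff Let_def
        matrix_vector_mult_def)
qed


section \<open>Stability and invariance\<close>

definition ode_solution :: "('a::real_normed_vector \<Rightarrow> 'a) \<Rightarrow> (real \<Rightarrow> 'a) \<Rightarrow> bool" where
  "ode_solution f e \<longleftrightarrow> (\<forall>t\<ge>0. (e has_vector_derivative f (e t)) (at t within {0..}))"

text \<open>Asymptotic stability of the equilibrium at the origin: Lyapunov stability together with
  attractivity. Attractivity is required from all initial values.\<close>

definition asymptotically_stable :: "('a::real_normed_vector \<Rightarrow> 'a) \<Rightarrow> bool" where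
  "asymptotically_stable f \<longleftrightarrow>
     f 0 = 0 \<and>
     (\<forall>\<epsilon>>0. \<exists>\<delta>>0. \<forall>e. ode_solution f e \<and> norm (e 0) < \<delta> \<longrightarrow> (\<forall>t\<ge>0. norm (e t) < \<epsilon>)) \<and>
     (\<forall>e. ode_solution f e \<longrightarrow> (e \<longlongrightarrow> 0) at_top)"

definition strictly_positively_invariant :: "('a::real_normed_vector \<Rightarrow> 'a) \<Rightarrow> 'a set \<Rightarrow> bool" where
  "strictly_positively_invariant f S \<longleftrightarrow>
     (\<forall>e. ode_solution f e \<and> e 0 \<in> S \<longrightarrow> (\<forall>t>0. e t \<in> S))"


section \<open>The sets \<open>\<Omega>\<close> and \<open>\<Sigma>\<close>\<close>

definition h_row :: "real \<Rightarrow> nat \<Rightarrow> real^'n::{finite,linorder}" where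
  "h_row lam k = - (eta 1 v* matrix_power (chain_A + lam *\<^sub>R mat 1) (k - 1))"

definition H_mat :: "real \<Rightarrow> real^('n::{finite,linorder})^('n::{finite,linorder})" where
  "H_mat lam = (\<chi> i. h_row lam (pos i))"

text \<open>The order on vectors is componentwise. The one-row matrix \<open>\<eta>\<^sub>1\<^sup>T\<close> has row index type \<open>1\<close>.
  Membership in \<open>\<Sigma>\<close> means \<open>\<eta>\<^sub>1\<^sup>T e\<^sub>i \<le> 0\<close> for all \<open>i\<close>; this is \<open>h\<^sub>1 e\<^sub>i \<ge> 0\<close>, the first row of \<open>H e\<^sub>i \<ge> 0\<close>.\<close>

definition Omega :: "real \<Rightarrow> (real^('N::finite \<times> 'n::{finite,linorder})) set" where
  "Omega lam = {e. ((mat 1 :: real^'N^'N) \<otimes>\<^sub>K (H_mat lam :: real^('n::{finite,linorder})^('n::{finite,linorder}))) *v e \<ge> 0}"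

definition Sigma_set :: "(real^('N::finite \<times> 'n::{finite,linorder})) set" where
  "Sigma_set = {e. ((mat 1 :: real^'N^'N) \<otimes>\<^sub>K (rowvector (eta 1) :: real^('n::{finite,linorder})^1)) *v e \<le> 0}"

end

theory Submission
  imports Defs "HOL-Real_Asymp.Real_Asymp"
begin

text \<open>For every follower the protocol reduces to \<open>v\<^sub>i = e\<^sub>i\<close>. In the coordinates
  \<open>q\<^sub>k = \<eta>\<^sub>1\<^sup>T (A + \<lambda>I)\<^sup>k e\<^sub>i\<close> with \<open>k < n\<close> the closed loop becomes the cascade
  \<open>q\<^sub>k' = q\<^sub>k\<^sub>+\<^sub>1 - \<lambda> q\<^sub>k\<close>, in which the feedback cancels the term \<open>q\<^sub>n\<close> of the last equation.
  A comparison principle for such cascades, proved from the last component down, shows that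
  \<open>q \<le> 0\<close>, which describes \<open>\<Omega>\<close>, is preserved, and that \<open>\<bar>q\<^sub>k\<bar>\<close> is dominated by the
  supersolution \<open>M (1 + t)\<^sup>n\<^sup>-\<^sup>k exp (-\<lambda>t)\<close>. The errors are recovered from the \<open>q\<^sub>k\<close> because
  \<open>A = (A + \<lambda>I) - \<lambda>I\<close> produces \<open>\<eta>\<^sub>m\<^sub>+\<^sub>1\<close> from \<open>\<eta>\<^sub>m\<close>.\<close>

section \<open>Unit rows, the chain and powers of the shifted chain\<close>

lemma inner_vector_matrix_mult:
  fixes u :: "real^'m" and M :: "real^'k^'m"
  shows "(u v* M) \<bullet> v = u \<bullet> (M *v v)"
  by (metis dot_lmul_matrix)

lemma matrix_power_commute: "matrix_power M k ** M = M ** matrix_power M k"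
  by (induction k) (simp_all add: matrix_mul_assoc[symmetric])

lemma eta_inner: "eta (pos i) \<bullet> x = x $ i" for x :: "real^'n::{finite,linorder}"
proof -
  have "pos j = pos i \<longleftrightarrow> j = i" for j
    using bij_betw_pos[where 'n='n] by (auto simp: bij_betw_def inj_eq)
  then show ?thesis
    by (simp add: eta_def inner_vec_def if_distrib[of "\<lambda>c. c * _"] cong: if_cong)
qed

lemma pos_bounds: "1 \<le> pos i" "pos i \<le> CARD('n)" for i :: "'n::{finite,linorder}"
  using bij_betw_pos[where 'n='n] by (auto simp: bij_betw_def)

lemma pos_obtain:
  assumes "1 \<le> k" "k \<le> CARD('n)"
  obtains i :: "'n::{finite,linorder}" where "pos i = k"
proof -
  have "k \<in> range (pos :: 'n \<Rightarrow> nat)"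
    using assms bij_betw_pos[where 'n='n] by (simp add: bij_betw_def)
  then show thesis
    using that by blast
qed

lemma eta_vector_matrix:
  fixes M :: "real^'m^('n::{finite,linorder})"
  shows "eta (pos i) v* M = M $ i"
proof -
  have "(eta (pos i) v* M) $ j = M $ i $ j" for j
    using eta_inner[of i "\<chi> i. M $ i $ j"]
    by (simp add: vector_matrix_mult_def inner_vec_def mult.commute)
  then show ?thesis
    by (simp add: vec_eq_iff)
qed

text \<open>The only 1 in row \<open>m\<close> of \<open>chain_A\<close> stands in column
  \<open>m + 1\<close>. No index has a position beyond \<open>CARD('n)\<close>, so
  \<open>eta\<close> vanishes there and the shift ends in zero. Row 0 is excluded because
  \<open>eta 0 = 0\<close> would have to be shifted to \<open>eta 1\<close>.\<close>

lemma eta_chain_A: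
  assumes "1 \<le> m"
  shows "eta m v* chain_A = (eta (Suc m) :: real^'n::{finite,linorder})"
proof (cases "m \<le> CARD('n)")
  case True
  with assms obtain i :: 'n where "pos i = m"
    by (rule pos_obtain)
  then show ?thesis
    using eta_vector_matrix[of i "chain_A :: ((real, 'n) vec, 'n) vec"]
    by (simp add: chain_A_def eta_def vec_eq_iff)
next
  case False
  then have "pos i \<noteq> m" "pos i \<noteq> Suc m" for i :: 'n
    using pos_bounds(2)[of i] by auto
  then show ?thesis
    by (simp add: eta_def vector_matrix_mult_def vec_eq_iff)
qed

text \<open>The rows of a Krylov sequence of the shifted chain. For \<open>m = 1\<close> they give
  the coordinates \<open>q\<^sub>k\<close>, the negatives of \<open>h_row\<close> and, at
  \<open>k = CARD('n)\<close>, the gain \<open>K_lin\<close>; a general start \<open>m\<close> is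
  what the inductions on \<open>k\<close> need.\<close>

definition krylov :: "real \<Rightarrow> nat \<Rightarrow> nat \<Rightarrow> real^'n::{finite,linorder}" where
  "krylov lam m k = eta m v* matrix_power (chain_A + lam *\<^sub>R mat 1) k"

lemma krylov_0 [simp]: "krylov lam m 0 = eta m"
  by (simp add: krylov_def)

lemma vector_shifted_chain:
  "u v* (chain_A + lam *\<^sub>R mat 1) = u v* chain_A + lam *\<^sub>R (u :: real^'n::{finite,linorder})"
proof -
  have "u v* (lam *\<^sub>R mat 1) = lam *\<^sub>R u"
    by (metis vector_matrix_mul_rid vector_scaleR_matrix_ac)
  then show ?thesis
    by (simp add: vec.add vector_matrix_mult_def distrib_left distrib_right sum.distrib vec_eq_iff)
qed

text \<open>The leftmost factor of the power is split off: on \<open>eta m\<close> it acts as the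
  shift plus \<open>lam\<close>. A power is thus traded for a higher row.\<close>

lemma krylov_Suc:
  assumes "1 \<le> m"
  shows "krylov lam m (Suc k) = krylov lam (Suc m) k + lam *\<^sub>R (krylov lam m k :: real^'n::{finite,linorder})"
proof -
  let ?M = "chain_A + lam *\<^sub>R mat 1 :: ((real, 'n) vec, 'n) vec"
  have "krylov lam m (Suc k) = (eta m v* ?M) v* matrix_power ?M k"
    by (simp add: krylov_def vector_matrix_mul_assoc)
  also have "\<dots> = (eta (Suc m) + lam *\<^sub>R eta m) v* matrix_power ?M k"
    by (simp add: vector_shifted_chain eta_chain_A[OF assms])
  also have "\<dots> = krylov lam (Suc m) k + lam *\<^sub>R krylov lam m k"
    by (simp add: krylov_def vector_matrix_left_distrib scaleR_vector_matrix_assoc)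
  finally show ?thesis .
qed

text \<open>Here a factor is split off on the right, since a matrix commutes with its powers. This
  gives the drift of the cascade.\<close>

lemma krylov_chain_A:
  "krylov lam m k v* chain_A = krylov lam m (Suc k) - lam *\<^sub>R (krylov lam m k :: real^'n::{finite,linorder})"
proof -
  have "krylov lam m (Suc k) = krylov lam m k v* (chain_A + lam *\<^sub>R mat 1 :: ((real, 'n) vec, 'n) vec)"
    by (simp add: krylov_def vector_matrix_mul_assoc matrix_power_commute)
  then show ?thesis
    by (simp add: vector_shifted_chain)
qed

text \<open>Each factor advances a row by at most one place, so the input, acting on the last
  coordinate, is invisible while \<open>m + k < CARD('n)\<close>; at equality only the pure shifts
  reach it. For \<open>m = 1\<close> the input enters the last cascade equation alone.\<close>

lemma krylov_chain_B:
  assumes "1 \<le> m" "m + k \<le> CARD('n)"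
  shows "krylov lam m k \<bullet> (chain_B :: real^'n::{finite,linorder}) = (if m + k = CARD('n) then 1 else 0)"
  using assms
proof (induction k arbitrary: m)
  case 0
  then obtain i :: 'n where "pos i = m"
    using pos_obtain by auto
  then show ?case
    using eta_inner[of i chain_B] by (simp add: chain_B_def eta_def)
next
  case (Suc k)
  then show ?case
    by (simp add: krylov_Suc inner_add_left)
qed

text \<open>The binomial theorem: \<open>chain_A\<close> commutes with multiples of the identity,
  and its powers shift \<open>eta m\<close>. For \<open>m = 1\<close> the sums are those imposed on
  the initial values.\<close>

lemma krylov_binomial:
  assumes "1 \<le> m"
  shows "krylov lam m k \<bullet> x =
    (\<Sum>j\<le>k. real (k choose j) * lam ^ j * (eta (m + k - j) \<bullet> (x :: real^'n::{finite,linorder})))"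
  using assms
proof (induction k arbitrary: m)
  case 0
  then show ?case by simp
next
  case (Suc k)
  define a where "a j = eta (m + Suc k - j) \<bullet> x" for j
  have "krylov lam m (Suc k) \<bullet> x = (\<Sum>j\<le>k. real (k choose j) * lam ^ j * a j)
      + lam * (\<Sum>j\<le>k. real (k choose j) * lam ^ j * a (Suc j))"
    using Suc by (simp add: krylov_Suc inner_add_left a_def)
  \<comment> \<open>The added term has coefficient \<open>k choose Suc k = 0\<close>; after the
    index shift, Pascal's rule applies term by term.\<close>
  also have "(\<Sum>j\<le>k. real (k choose j) * lam ^ j * a j)
      = (\<Sum>j\<le>Suc k. real (k choose j) * lam ^ j * a j)"
    by simp
  also have "\<dots> = a 0 + (\<Sum>j\<le>k. real (k choose Suc j) * lam ^ Suc j * a (Suc j))"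
    by (subst sum.atMost_Suc_shift) simp
  also have "\<dots> + lam * (\<Sum>j\<le>k. real (k choose j) * lam ^ j * a (Suc j))
      = a 0 + (\<Sum>j\<le>k. real (Suc k choose Suc j) * lam ^ Suc j * a (Suc j))"
    by (simp add: sum_distrib_left sum.distrib[symmetric] algebra_simps)
  also have "\<dots> = (\<Sum>j\<le>Suc k. real (Suc k choose j) * lam ^ j * a j)"
    by (simp only: sum.atMost_Suc_shift) simp
  finally show ?case by (simp add: a_def)
qed

text \<open>Read backwards, \<open>krylov_Suc\<close> raises the row at the cost of one more power,
  hence \<open>m + k < n\<close>, and of a factor \<open>1 + lam\<close>. At \<open>k = 0\<close>
  this bounds the coordinates of \<open>x\<close> themselves.\<close>

lemma krylov_bound:
  fixes x :: "real^'n::{finite,linorder}"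
  assumes "0 \<le> lam" and M: "\<And>k. k < n \<Longrightarrow> \<bar>krylov lam 1 k \<bullet> x\<bar> \<le> M"
  shows "m + k < n \<Longrightarrow> \<bar>krylov lam (Suc m) k \<bullet> x\<bar> \<le> (1 + lam) ^ m * M"
proof (induction m arbitrary: k)
  case 0
  then show ?case using M by simp
next
  case (Suc m)
  have "krylov lam (Suc (Suc m)) k \<bullet> x = krylov lam (Suc m) (Suc k) \<bullet> x - lam * (krylov lam (Suc m) k \<bullet> x)"
    by (simp add: krylov_Suc inner_add_left)
  also have "\<bar>\<dots>\<bar> \<le> \<bar>krylov lam (Suc m) (Suc k) \<bullet> x\<bar> + lam * \<bar>krylov lam (Suc m) k \<bullet> x\<bar>"
    using assms(1) by (metis abs_mult abs_of_nonneg abs_triangle_ineq4)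
  also have "\<dots> \<le> (1 + lam) ^ m * M + lam * ((1 + lam) ^ m * M)"
    using Suc assms(1) by (intro add_mono mult_left_mono) auto
  finally show ?case
    by (simp add: algebra_simps)
qed

section \<open>Cascades of scalar differential inequalities\<close>

lemma cascade_comparison:
  fixes y d :: "nat \<Rightarrow> real \<Rightarrow> real"
  assumes deriv: "\<And>k t. k < n \<Longrightarrow> 0 \<le> t \<Longrightarrow> (y k has_real_derivative d k t) (at t within {0..})"
    and le: "\<And>k t. k < n \<Longrightarrow> 0 \<le> t \<Longrightarrow> d k t \<le> (if Suc k < n then y (Suc k) t else 0) - lam * y k t"
    and init: "\<And>k. k < n \<Longrightarrow> y k 0 \<le> 0"
    and "k < n" "0 \<le> t"
  shows "y k t \<le> 0"
  using \<open>k < n\<close> \<open>0 \<le> t\<close>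
proof (induction "n - k" arbitrary: k t rule: less_induct)
  case less
  have upper: "(if Suc k < n then y (Suc k) s else 0) \<le> 0" if "0 \<le> s" for s
    using less that by auto
  \<comment> \<open>Integrating factor: \<open>?p\<close> has the sign of \<open>y k\<close>, and
    its derivative is nonpositive once the next component is.\<close>
  let ?p = "\<lambda>s. exp (lam * s) * y k s"
  let ?p' = "\<lambda>s. exp (lam * s) * d k s + lam * exp (lam * s) * y k s"
  have p: "(?p has_real_derivative ?p' s) (at s within {0..})" if "0 \<le> s" for s
    by (rule derivative_eq_intros deriv less that refl)+ (simp add: algebra_simps)
  have "?p t \<le> ?p 0"
  \<comment> \<open>At 0 the derivative is only one-sided, so the endpoints are covered by
    continuity and two-sided derivatives are taken inside.\<close>
  proof (rule DERIV_nonpos_imp_decreasing_open[OF less.prems(2)])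
    fix s assume s: "0 < s" "s < t"
    have "(?p has_real_derivative ?p' s) (at s)"
      using p[of s] s by (simp add: at_within_interior[of s "{0..}"])
    moreover have "?p' s = exp (lam * s) * (d k s + lam * y k s)"
      by (simp add: algebra_simps)
    moreover have "d k s + lam * y k s \<le> 0"
      using le[of k s] upper[of s] less.prems s by simp
    ultimately show "\<exists>y. (?p has_real_derivative y) (at s) \<and> y \<le> 0"
      by (metis exp_ge_zero mult_nonneg_nonpos)
  next
    have "continuous_on {0..} ?p"
      using p by (intro DERIV_continuous_on[of _ _ ?p']) auto
    then show "continuous_on {0..t} ?p"
      by (rule continuous_on_subset) auto
  qed
  also have "?p 0 \<le> 0"
    using init less.prems by simp
  finally show ?case
    by (simp add: mult_le_0_iff not_le)
qed

lemma cascade_decay: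
  fixes y :: "nat \<Rightarrow> real \<Rightarrow> real"
  assumes deriv: "\<And>k t. k < n \<Longrightarrow> 0 \<le> t \<Longrightarrow>
      (y k has_real_derivative (if Suc k < n then y (Suc k) t else 0) - lam * y k t) (at t within {0..})"
    and init: "\<And>k. k < n \<Longrightarrow> \<bar>y k 0\<bar> \<le> M"
    and "k < n" "0 \<le> t"
  shows "\<bar>y k t\<bar> \<le> M * (1 + t) ^ n * exp (- lam * t)"
proof -
  \<comment> \<open>Differentiating the power yields \<open>n - k \<ge> 1\<close> times the next
    component, so \<open>b\<close> satisfies the cascade with \<ge> in place of equality.\<close>
  define b where "b k t = M * (1 + t) ^ (n - k) * exp (- lam * t)" for k t
  have "0 \<le> M"
    using init[OF \<open>k < n\<close>] by linarith
  have b_deriv: "(b k has_real_derivative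
      real (n - k) * (M * (1 + t) ^ (n - Suc k) * exp (- lam * t)) - lam * b k t) (at t within {0..})" for k t
    unfolding b_def by (auto intro!: derivative_eq_intros simp: algebra_simps)
  have b_super: "(if Suc k < n then b (Suc k) t else 0)
      \<le> real (n - k) * (M * (1 + t) ^ (n - Suc k) * exp (- lam * t))" if "k < n" "0 \<le> t" for k t
  proof -
    let ?c = "M * (1 + t) ^ (n - Suc k) * exp (- lam * t)"
    have "0 \<le> ?c"
      using \<open>0 \<le> M\<close> that by simp
    moreover from this have "1 * ?c \<le> real (n - k) * ?c"
      using that by (intro mult_right_mono) auto
    ultimately show ?thesis
      unfolding b_def by (smt (verit))
  qed
  have b_0: "b k 0 = M" for k
    by (simp add: b_def)
  \<comment> \<open>Both signs \<open>s\<close> are needed to bound the absolute value. The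
    difference satisfies only an inequality, which is the form that
    \<open>cascade_comparison\<close> accepts.\<close>
  have sgn: "s * y k t - b k t \<le> 0" if s: "\<bar>s\<bar> = 1" for s
  proof (rule cascade_comparison[where y = "\<lambda>k t. s * y k t - b k t" and n = n and lam = lam])
    fix k and t :: real assume kt: "k < n" "0 \<le> t"
    show "((\<lambda>t. s * y k t - b k t) has_real_derivative
        s * ((if Suc k < n then y (Suc k) t else 0) - lam * y k t)
        - (real (n - k) * (M * (1 + t) ^ (n - Suc k) * exp (- lam * t)) - lam * b k t)) (at t within {0..})"
      by (intro DERIV_diff DERIV_cmult deriv kt b_deriv)
    show "s * ((if Suc k < n then y (Suc k) t else 0) - lam * y k t)
        - (real (n - k) * (M * (1 + t) ^ (n - Suc k) * exp (- lam * t)) - lam * b k t)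
        \<le> (if Suc k < n then s * y (Suc k) t - b (Suc k) t else 0) - lam * (s * y k t - b k t)"
      using b_super[OF kt] by (auto simp: algebra_simps)
  next
    fix k assume "k < n"
    have "s * y k 0 \<le> \<bar>s * y k 0\<bar>" by simp
    also have "\<dots> \<le> M" using init[OF \<open>k < n\<close>] s by (simp add: abs_mult)
    finally show "s * y k 0 - b k 0 \<le> 0" by (simp add: b_0)
  qed (use assms in auto)
  have "\<bar>y k t\<bar> \<le> b k t"
    using sgn[of 1] sgn[of "-1"] by auto
  also have "\<dots> \<le> M * (1 + t) ^ n * exp (- lam * t)"
    unfolding b_def using \<open>0 \<le> M\<close> \<open>0 \<le> t\<close>
    by (intro mult_right_mono mult_left_mono power_increasing) auto
  finally show ?thesis .
qed

section \<open>The closed loop in cascade coordinates\<close>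

lemma block_closed_loop_eq:
  assumes "leader_rooted E"
  shows "block (closed_loop E lam e) i =
    chain_A *v block e i - (K_lin lam \<bullet> block e i) *\<^sub>R (chain_B :: real^'n::{finite,linorder})"
proof -
  let ?x = "relative_state e"
  \<comment> \<open>Relative states put the leader at 0, so the transmitted vectors are the blocks
    of \<open>e\<close>.\<close>
  have "error ?x = e"
    by (simp add: error_def relative_state_def block_def vec_eq_iff)
  then show ?thesis
    using block_closed_loop[OF assms transmitted_exists[OF assms, of ?x], of lam i]
    by (simp add: control_def relative_state_def)
qed

lemma bounded_linear_block: "bounded_linear (\<lambda>e. block e i)"
  by (auto intro!: linear_conv_bounded_linear[THEN iffD1] linearI simp: block_def vec_eq_iff)

lemma closed_loop_cascade:
  fixes e :: "real \<Rightarrow> real^('N::finite \<times> 'n::{finite,linorder})" and i :: 'N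
  assumes "leader_rooted E" "ode_solution (closed_loop E lam) e" "k < CARD('n)" "0 \<le> t"
  defines "q \<equiv> \<lambda>k t. krylov lam 1 k \<bullet> block (e t) i"
  shows "(q k has_real_derivative (if Suc k < CARD('n) then q (Suc k) t else 0) - lam * q k t) (at t within {0..})"
proof -
  have "(e has_vector_derivative closed_loop E lam (e t)) (at t within {0..})"
    using assms by (simp add: ode_solution_def)
  then have "(q k has_vector_derivative krylov lam 1 k \<bullet> block (closed_loop E lam (e t)) i) (at t within {0..})"
    unfolding q_def
    by (intro bounded_linear.has_vector_derivative[OF bounded_linear_inner_right]
        bounded_linear.has_vector_derivative[OF bounded_linear_block])
  moreover have "krylov lam 1 k \<bullet> (chain_A *v x) = krylov lam 1 (Suc k) \<bullet> x - lam * (krylov lam 1 k \<bullet> x)"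
    for x :: "(real, 'n) vec"
    by (simp add: inner_vector_matrix_mult[symmetric] krylov_chain_A inner_diff_left)
  \<comment> \<open>The feedback is the coordinate that would follow the last one, so at
    \<open>Suc k = CARD('n)\<close> it cancels exactly the coupling term.\<close>
  moreover have "K_lin lam = (krylov lam 1 CARD('n) :: (real, 'n) vec)"
    by (simp add: K_lin_def krylov_def)
  moreover have "krylov lam 1 CARD('n) = (krylov lam 1 (Suc k) :: (real, 'n) vec)" if "\<not> Suc k < CARD('n)"
    using that assms(3) by (intro arg_cong[where f = "krylov lam 1"]) simp
  ultimately show ?thesis
    using assms(3) krylov_chain_B[where 'n='n, of 1 k lam]
    by (auto simp: block_closed_loop_eq[OF assms(1)] inner_diff_right q_def
        has_real_derivative_iff_has_vector_derivative)
qed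

section \<open>\<open>Omega\<close> and \<open>Sigma_set\<close> in cascade coordinates, and
  invariance\<close>

lemma kronecker_identity_mult:
  fixes P :: "real^'n^'m"
  shows "((mat 1 :: real^'N^'N) \<otimes>\<^sub>K P) *v e = (\<chi> p. (P *v block e (fst p)) $ snd p)"
proof -
  have "(((mat 1 :: real^'N^'N) \<otimes>\<^sub>K P) *v e) $ (i, j) = (P *v block e i) $ j" for i j
  proof -
    have "(((mat 1 :: real^'N^'N) \<otimes>\<^sub>K P) *v e) $ (i, j)
        = (\<Sum>(a, b)\<in>UNIV \<times> UNIV. (if a = i then P $ j $ b * e $ (a, b) else 0))"
      by (auto simp: matrix_vector_mult_def kronecker_def mat_def intro!: sum.cong)
    also have "\<dots> = (\<Sum>a\<in>UNIV. if a = i then (\<Sum>b\<in>UNIV. P $ j $ b * e $ (a, b)) else 0)"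
      by (subst sum.cartesian_product[symmetric]) (rule sum.cong, auto)
    finally show ?thesis
      by (simp add: matrix_vector_mult_def block_def)
  qed
  then show ?thesis
    by (simp add: vec_eq_iff)
qed

lemma Omega_iff:
  "e \<in> Omega lam \<longleftrightarrow> (\<forall>i. \<forall>k<CARD('n). krylov lam 1 k \<bullet> block (e :: real^('N::finite \<times> 'n::{finite,linorder})) i \<le> 0)"
proof -
  \<comment> \<open>The minus sign in \<open>h_row\<close> reverses the inequality; its exponent
    \<open>k - 1\<close> leads to cascade indices starting at 0.\<close>
  have *: "e \<in> Omega lam \<longleftrightarrow> (\<forall>i. \<forall>j::'n. krylov lam 1 (pos j - 1) \<bullet> block e i \<le> 0)"
    by (simp add: Omega_def kronecker_identity_mult less_eq_vec_def matrix_vector_mul_component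
        H_mat_def h_row_def krylov_def)
  have reindex: "(\<forall>j::'n. P (pos j - 1)) \<longleftrightarrow> (\<forall>k<CARD('n). P k)" for P
  proof safe
    fix k assume P: "\<forall>j::'n. P (pos j - 1)" and "k < CARD('n)"
    then obtain j :: 'n where "pos j = Suc k"
      using pos_obtain[of "Suc k", where 'n='n] by auto
    with P show "P k"
      by (metis diff_Suc_1)
  next
    fix j :: 'n assume "\<forall>k<CARD('n). P k"
    then show "P (pos j - 1)"
      using pos_bounds[of j] by simp
  qed
  show ?thesis
    unfolding * by (intro all_cong1 reindex)
qed

lemma Sigma_set_iff: "e \<in> Sigma_set \<longleftrightarrow> (\<forall>i. eta 1 \<bullet> block e i \<le> 0)"
  by (simp add: Sigma_set_def kronecker_identity_mult less_eq_vec_def matrix_vector_mul_component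
      rowvector_def)

lemma strictly_positively_invariant_Omega:
  assumes "leader_rooted E"
  shows "strictly_positively_invariant (closed_loop E lam)
    (Omega lam :: (real^('N::finite \<times> 'n::{finite,linorder})) set)"
  unfolding strictly_positively_invariant_def Omega_iff
proof (intro allI impI; elim conjE)
  fix e :: "real \<Rightarrow> real^('N \<times> 'n)" and t :: real and i k
  assume sol: "ode_solution (closed_loop E lam) e"
    and init: "\<forall>i. \<forall>k<CARD('n). krylov lam 1 k \<bullet> block (e 0) i \<le> 0" and "0 < t" "k < CARD('n)"
  show "krylov lam 1 k \<bullet> block (e t) i \<le> 0"
  \<comment> \<open>Each follower has its own cascade, which holds with equality.\<close>
  proof (rule cascade_comparison[where n = "CARD('n)" and lam = lam
        and y = "\<lambda>k t. krylov lam 1 k \<bullet> block (e t) i"])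
    show "krylov lam 1 k \<bullet> block (e 0) i \<le> 0" if "k < CARD('n)" for k
      using init that by blast
  qed (use closed_loop_cascade[OF assms sol] \<open>0 < t\<close> \<open>k < CARD('n)\<close> in auto)
qed

section \<open>Decay of the error and asymptotic stability\<close>

lemma norm_block_le: "norm (block e i) \<le> real CARD('n) * norm (e :: real^('N::finite \<times> 'n::finite))"
proof -
  have "norm (block e i) \<le> (\<Sum>k\<in>UNIV. \<bar>block e i $ k\<bar>)"
    by (rule norm_le_l1_cart)
  also have "\<dots> \<le> (\<Sum>k\<in>(UNIV::'n set). norm e)"
    by (intro sum_mono) (simp add: block_def component_le_norm_cart)
  finally show ?thesis
    by simp
qed

text \<open>One \<open>C\<close> serves all solutions and the bound is linear in
  \<open>norm (e 0)\<close>, so it yields both stability and attractivity.\<close>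

lemma closed_loop_decay:
  assumes "leader_rooted E" "0 \<le> lam"
  obtains C where "0 \<le> C" "\<And>(e :: real \<Rightarrow> real^('N::finite \<times> 'n::{finite,linorder})) t.
    ode_solution (closed_loop E lam) e \<Longrightarrow> 0 \<le> t \<Longrightarrow>
    norm (e t)
      \<le> C * norm (e 0) * ((1 + t) ^ CARD('n) * exp (- lam * t))"
proof -
  let ?n = "CARD('n)"
  \<comment> \<open>\<open>L\<close> bounds the initial cascade coordinates by Cauchy-Schwarz.
    \<open>C\<close> adds the factor of \<open>krylov_bound\<close> for the way back to the error
    and the number of coordinates for the l1 bound.\<close>
  define L where "L = (\<Sum>k<?n. norm (krylov lam 1 k :: (real, 'n) vec)) * real ?n"
  define C where "C = real CARD('N \<times> 'n) * ((1 + lam) ^ ?n * L)"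
  have "0 \<le> L"
    by (simp add: L_def sum_nonneg)
  show thesis
  proof
    show "0 \<le> C"
      using \<open>0 \<le> L\<close> assms(2) by (simp add: C_def)
    fix e :: "real \<Rightarrow> real^('N \<times> 'n)" and t :: real
    assume sol: "ode_solution (closed_loop E lam) e" and "0 \<le> t"
    define M where "M = L * norm (e 0) * (1 + t) ^ ?n * exp (- lam * t)"
    have "0 \<le> M"
      using \<open>0 \<le> L\<close> \<open>0 \<le> t\<close> by (simp add: M_def)
    have init: "\<bar>krylov lam 1 k \<bullet> block (e 0) i\<bar> \<le> L * norm (e 0)" if "k < ?n" for k i
    proof -
      have "norm (krylov lam 1 k :: (real, 'n) vec) \<le> (\<Sum>k<?n. norm (krylov lam 1 k :: (real, 'n) vec))"
        using that by (intro member_le_sum) auto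
      then have "norm (krylov lam 1 k :: (real, 'n) vec) * norm (block (e 0) i)
          \<le> (\<Sum>k<?n. norm (krylov lam 1 k :: (real, 'n) vec)) * (real ?n * norm (e 0))"
        by (intro mult_mono norm_block_le) (auto intro: sum_nonneg)
      with Cauchy_Schwarz_ineq2[of "krylov lam 1 k" "block (e 0) i"] show ?thesis
        by (simp add: L_def mult.assoc)
    qed
    have q: "\<bar>krylov lam 1 k \<bullet> block (e t) i\<bar> \<le> M" if "k < ?n" for k i
      unfolding M_def using init that \<open>0 \<le> t\<close>
      by (intro cascade_decay[OF closed_loop_cascade[OF assms(1) sol]]) auto
    have comp: "\<bar>e t $ (i, j)\<bar> \<le> (1 + lam) ^ ?n * M" for i j
    proof -
      have "\<bar>krylov lam (Suc (pos j - 1)) 0 \<bullet> block (e t) i\<bar> \<le> (1 + lam) ^ (pos j - 1) * M"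
        using pos_bounds[of j] by (intro krylov_bound[OF assms(2), of ?n] q) auto
      also have "\<dots> \<le> (1 + lam) ^ ?n * M"
        using pos_bounds[of j] assms(2) \<open>0 \<le> M\<close> by (intro mult_right_mono power_increasing) auto
      finally show ?thesis
        using pos_bounds[of j] eta_inner[of j "block (e t) i"] by (simp add: block_def)
    qed
    have "norm (e t) \<le> (\<Sum>p\<in>UNIV. \<bar>e t $ p\<bar>)"
      by (rule norm_le_l1_cart)
    also have "\<dots> \<le> (\<Sum>p\<in>(UNIV :: ('N \<times> 'n) set). (1 + lam) ^ ?n * M)"
      using comp by (intro sum_mono) (metis surj_pair)
    finally show "norm (e t) \<le> C * norm (e 0) * ((1 + t) ^ ?n * exp (- lam * t))"
      by (simp add: C_def M_def mult.assoc mult.left_commute)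
  qed
qed

text \<open>A single term of the exponential series at \<open>lam * (1 + t)\<close> is at most the
  whole series.\<close>

lemma power_times_exp_bound:
  fixes lam :: real
  assumes "0 < lam" "0 \<le> t"
  shows "(1 + t) ^ n * exp (- lam * t) \<le> fact n * exp lam / lam ^ n"
proof -
  have "(lam * (1 + t)) ^ n / fact n \<le> exp (lam * (1 + t))"
    using assms summable_exp_generic[of "lam * (1 + t)"]
    by (auto simp: exp_def divide_inverse mult.commute intro!: sum_le_suminf[of _ "{n}", simplified])
  then have "(1 + t) ^ n * lam ^ n \<le> fact n * exp lam * exp (lam * t)"
    by (simp add: distrib_left[of lam] exp_add pos_divide_le_eq mult_ac flip: power_mult_distrib)
  then show ?thesis
    using assms by (simp add: field_simps exp_minus)
qed

lemma asymptotically_stable_closed_loop: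
  assumes "leader_rooted E" "0 < lam"
  shows "asymptotically_stable
    (closed_loop E lam :: real^('N::finite \<times> 'n::{finite,linorder}) \<Rightarrow> real^('N \<times> 'n))"
    (is "asymptotically_stable ?f")
proof -
  let ?n = "CARD('n)"
  obtain C where C: "0 \<le> C" "\<And>e t. ode_solution ?f e \<Longrightarrow> 0 \<le> t \<Longrightarrow>
      norm (e t) \<le> C * norm (e 0) * ((1 + t) ^ ?n * exp (- lam * t))"
    using closed_loop_decay[OF assms(1) less_imp_le[OF assms(2)]] by blast
  \<comment> \<open>The summand 1 keeps \<open>D\<close> positive even for \<open>C = 0\<close>, so
    that \<open>\<epsilon> / D\<close> can serve as \<delta>.\<close>
  define D where "D = C * (fact ?n * exp lam / lam ^ ?n) + 1"
  have "0 < D"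
    using C(1) assms(2) by (simp add: D_def add_nonneg_pos)
  have D: "norm (e t) \<le> D * norm (e 0)" if "ode_solution ?f e" "0 \<le> t" for e t
  proof -
    have "norm (e t) \<le> C * norm (e 0) * (fact ?n * exp lam / lam ^ ?n)"
      using power_times_exp_bound[OF assms(2) that(2), of ?n] C(1)
      by (intro order_trans[OF C(2)[OF that]] mult_left_mono) auto
    also have "\<dots> \<le> D * norm (e 0)"
      by (simp add: D_def algebra_simps)
    finally show ?thesis .
  qed
  have block0: "block (0 :: real^('N \<times> 'n)) i = 0" for i
    by (simp add: block_def vec_eq_iff)
  have "block (?f 0) i = 0" for i
    by (simp add: block_closed_loop_eq[OF assms(1)] block0)
  then have "?f 0 = 0"
    by (simp add: block_def vec_eq_iff)
  moreover have "\<exists>\<delta>>0. \<forall>e. ode_solution ?f e \<and> norm (e 0) < \<delta> \<longrightarrow> (\<forall>t\<ge>0. norm (e t) < \<epsilon>)"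
    if "0 < \<epsilon>" for \<epsilon>
  proof (intro exI[of _ "\<epsilon> / D"] conjI allI impI; (elim conjE)?)
    show "0 < \<epsilon> / D"
      using that \<open>0 < D\<close> by simp
    fix e and t :: real assume "ode_solution ?f e" "norm (e 0) < \<epsilon> / D" "0 \<le> t"
    moreover from this have "D * norm (e 0) < \<epsilon>"
      using \<open>0 < D\<close> by (simp add: field_simps)
    ultimately show "norm (e t) < \<epsilon>"
      using D[of e t] by linarith
  qed
  moreover have "(e \<longlongrightarrow> 0) at_top" if "ode_solution ?f e" for e
  proof (rule Lim_null_comparison)
    show "\<forall>\<^sub>F t in at_top. norm (e t) \<le> C * norm (e 0) * ((1 + t) ^ ?n * exp (- lam * t))"
      by (rule eventually_mono[OF eventually_ge_at_top[of 0]]) (rule C(2)[OF that])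
    have "((\<lambda>t. (1 + t) ^ n * exp (- lam * t)) \<longlongrightarrow> 0) at_top" for n
      using assms(2) by real_asymp
    then show "((\<lambda>t. C * norm (e 0) * ((1 + t) ^ ?n * exp (- lam * t))) \<longlongrightarrow> 0) at_top"
      by (rule tendsto_mult_right_zero)
  qed
  ultimately show ?thesis
    unfolding asymptotically_stable_def by blast
qed

theorem theorem2:
  fixes E :: "('N::finite option \<times> 'N option) set"
    and lam :: real
  assumes "leader_rooted E"
    and "lam > 0"
  shows "asymptotically_stable
           (closed_loop E lam :: real^('N \<times> 'n::{finite,linorder}) \<Rightarrow> real^('N \<times> 'n))
       \<and> (Omega lam :: (real^('N \<times> 'n)) set) \<subseteq> Sigma_set
       \<and> strictly_positively_invariant
           (closed_loop E lam) (Omega lam :: (real^('N \<times> 'n)) set)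
       \<and> (\<forall>e0 :: real^('N \<times> 'n).
            e0 \<in> Sigma_set \<and>
            (\<forall>k\<in>{2..CARD('n)}. \<forall>i.
               (\<Sum>\<zeta>=0..k-1. real ((k - 1) choose \<zeta>) * lam ^ \<zeta> * (eta (k - \<zeta>) \<bullet> block e0 i)) \<le> 0)
            \<longrightarrow> e0 \<in> Omega lam)"
proof (intro conjI subsetI allI impI; (elim conjE)?)
  fix e :: "real^('N \<times> 'n)" assume "e \<in> Omega lam"
  then show "e \<in> Sigma_set"
    unfolding Omega_iff Sigma_set_iff by (metis krylov_0 zero_less_card_finite)
next
  fix e0 :: "real^('N \<times> 'n)"
  assume Sig: "e0 \<in> Sigma_set"
    and le: "\<forall>k\<in>{2..CARD('n)}. \<forall>i.
      (\<Sum>\<zeta>=0..k-1. real ((k - 1) choose \<zeta>) * lam ^ \<zeta> * (eta (k - \<zeta>) \<bullet> block e0 i)) \<le> 0"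
  show "e0 \<in> Omega lam"
    unfolding Omega_iff
  proof (intro allI impI)
    fix i k assume k: "k < CARD('n)"
    show "krylov lam 1 k \<bullet> block e0 i \<le> 0"
    proof (cases "k = 0")
      \<comment> \<open>The inequalities on the initial values start at \<open>k = 2\<close>; the
        first row of H is supplied by \<open>Sigma_set\<close>.\<close>
      case True
      with Sig show ?thesis by (simp add: Sigma_set_iff)
    next
      case False
      \<comment> \<open>Power \<open>k\<close> belongs to row \<open>Suc k\<close> of H.\<close>
      with k have "Suc k \<in> {2..CARD('n)}" by auto
      with le have "(\<Sum>\<zeta>=0..Suc k-1. real ((Suc k - 1) choose \<zeta>) * lam ^ \<zeta> * (eta (Suc k - \<zeta>) \<bullet> block e0 i)) \<le> 0"
        by blast
      then show ?thesis
        by (simp add: krylov_binomial atLeast0AtMost)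
    qed
  qed
qed (use assms asymptotically_stable_closed_loop strictly_positively_invariant_Omega in blast)+

end
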